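(* Let $W\in\mathbb R^{m\times m}$, $b,c\in\mathbb R^m$ be given by $$W:=\frac12\Lambda(L)^{-1},\qquad b:=\alpha\big(B^\top\mu_{k+1}+2\Sigma(L)x_k\big),\qquad c:=\alpha\,\mathcal W_{u_d}(L)$$ for the data described in the context (for a fixed stage, so that $x_k,\mu_{k+1}\in\mathbb R^n$ are fixed vectors). For any $z^0\in\mathbb R^m$ and some $0<\omega<2$, consider the recursion in $k=1,2,\ldots$, carried out for increasing $i=1,\ldots,m$, $$z_i^k=(1-\omega)z_i^{k-1}-\frac{\omega}{W_{i,i}}\Big(\sum_{j=1}^{i-1}W_{i,j}(\gamma_j^k+b_j)+\sum_{j=i+1}^{m}W_{i,j}(\gamma_j^{k-1}+b_j)\Big)-\omega b_i,$$ with $$\gamma^k=\min\{c,|z^k|\}\odot\mathrm{sign}(z^k),\qquad \nu^k=\max\{0,\,W_d\odot(|z^k|-c)\}\odot\mathrm{sign}(z^k).$$ Then $\gamma^k\to\gamma^*$ and $\nu^k\to v^*$, where $\gamma^*,v^*$ satisfy the generalized normal equation $$W^{-1}u+b+\gamma=0,\qquad \gamma\in\{c\odot\xi:\ \xi\in\partial(|u|)\}$$ with $u=v^*$, $\gamma=\gamma^*$.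
   Context: Data: $\alpha>0$, $A,\overline\sigma_x\in\mathbb R^{n\times n}$, $B,\sigma_u,\overline\sigma_u\in\mathbb R^{n\times m}$, $C\in\mathbb R^{p\times n}$, $D\in\mathbb R^{p\times m}$ with $D^\top D\succ0$. For symmetric positive semidefinite $U\in\mathbb R^{n\times n}$: $\mathcal Z_x(U)=\mathrm{Diag}(\overline\sigma_x^\top U\overline\sigma_x)$, $\mathcal Z_u(U)=\mathrm{Diag}(\overline\sigma_u^\top U\overline\sigma_u)$, $\mathcal W_u(U)=\mathrm{Diag}(\overline\sigma_u^\top U\sigma_u+\sigma_u^\top U\overline\sigma_u)$ and $\mathcal W_{u_d}(U)\in\mathbb R^m$ is the vector on the diagonal of $\mathcal W_u(U)$; $\Sigma(U)=B^\top UA+\alpha^{-1}D^\top C$; $\Lambda(U)=B^\top UB+\mathcal Z_u(U)+\alpha^{-1}D^\top D$; $\mathrm{Ric}^\alpha(U)=\alpha(A^\top UA+\mathcal Z_x(U))-\alpha\Sigma(U)^\top\Lambda(U)^{-1}\Sigma(U)+C^\top C$. Here $\mathrm{Diag}(U)$ is the diagonal matrix formed by the main diagonal of $U$. $L\succeq0$ is a solution of $U-\mathrm{Ric}^\alpha(U)=0$. Standing assumptions: $\Lambda$ is invertible and $\mathcal W_u$ is a linear-positive operator ($U\succeq0$ implies $\mathcal W_u(U)\succeq0$, so $\mathcal W_{u_d}(U)$ has nonnegative entries). Thus $W\succ0$ and $c\ge0$ componentwise. Notation: $W_{i,j}$ is the $(i,j)$ entry of $W$ and $W_d\in\mathbb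 R^m$ is its diagonal as a vector; $\odot$ is the Hadamard (componentwise) product; $|\cdot|$, $\min$, $\max$, $\mathrm{sign}$ on vectors are componentwise, $\mathrm{sign}(0)=0$. The initial $\gamma^0$ is obtained from $z^0$ by the same formula. $\partial(|u|)$ is the set of vectors $\xi\in\mathbb R^m$ with $\xi_i=\mathrm{sign}(u_i)$ if $u_i\ne0$ and $\xi_i\in[-1,1]$ if $u_i=0$. *)

theory Defs
  imports "HOL-Analysis.Analysis"
begin

text \<open>An \<open>r \<times> s\<close> real matrix has type \<open>real ^ 's ^ 'r\<close> (number of columns first). On vectors,
  \<open>x * y\<close> is the componentwise (Hadamard) product of the library.\<close>

definition psd :: "real ^ 'n ^ 'n \<Rightarrow> bool" where
  "psd U \<longleftrightarrow> transpose U = U \<and> (\<forall>x. 0 \<le> x \<bullet> (U *v x))"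

definition pd :: "real ^ 'n ^ 'n \<Rightarrow> bool" where
  "pd U \<longleftrightarrow> transpose U = U \<and> (\<forall>x. x \<noteq> 0 \<longrightarrow> 0 < x \<bullet> (U *v x))"

definition linear_positive :: "(real ^ 'n ^ 'n \<Rightarrow> real ^ 'm ^ 'm) \<Rightarrow> bool" where
  "linear_positive F \<longleftrightarrow> linear F \<and> (\<forall>U. psd U \<longrightarrow> psd (F U))"

definition diag_vec :: "real ^ 'm ^ 'm \<Rightarrow> real ^ 'm" where
  "diag_vec M = (\<chi> i. M $ i $ i)"

definition Diag :: "real ^ 'm ^ 'm \<Rightarrow> real ^ 'm ^ 'm" where
  "Diag M = (\<chi> i j. if i = j then M $ i $ j else 0)"

text \<open>\<open>Z_op\<close> serves for both \<open>Z_x\<close> (with \<open>s = \<sigma>bar_x\<close>) and \<open>Z_u\<close> (with \<open>s = \<sigma>bar_u\<close>). In the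
  operators below \<open>sx\<close>, \<open>su\<close> are the barred matrices \<open>\<sigma>bar_x\<close>, \<open>\<sigma>bar_u\<close>, and \<open>s\<close> in \<open>Wu_op\<close> is
  the unbarred \<open>\<sigma>_u\<close>.\<close>

definition Z_op :: "real ^ 'k ^ 'n \<Rightarrow> real ^ 'n ^ 'n \<Rightarrow> real ^ 'k ^ 'k" where
  "Z_op s U = Diag (transpose s ** U ** s)"

definition Wu_op :: "real ^ 'm ^ 'n \<Rightarrow> real ^ 'm ^ 'n \<Rightarrow> real ^ 'n ^ 'n \<Rightarrow> real ^ 'm ^ 'm" where
  "Wu_op s su U = Diag (transpose su ** U ** s + transpose s ** U ** su)"

definition Sigma_op ::
  "real \<Rightarrow> real ^ 'n ^ 'n \<Rightarrow> real ^ 'm ^ 'n \<Rightarrow> real ^ 'n ^ 'p \<Rightarrow> real ^ 'm ^ 'p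
    \<Rightarrow> real ^ 'n ^ 'n \<Rightarrow> real ^ 'n ^ 'm" where
  "Sigma_op \<alpha> A B C D U = transpose B ** U ** A + inverse \<alpha> *\<^sub>R (transpose D ** C)"

definition Lambda_op ::
  "real \<Rightarrow> real ^ 'm ^ 'n \<Rightarrow> real ^ 'm ^ 'p \<Rightarrow> real ^ 'm ^ 'n
    \<Rightarrow> real ^ 'n ^ 'n \<Rightarrow> real ^ 'm ^ 'm" where
  "Lambda_op \<alpha> B D su U =
     transpose B ** U ** B + Z_op su U + inverse \<alpha> *\<^sub>R (transpose D ** D)"

definition Ric_op ::
  "real \<Rightarrow> real ^ 'n ^ 'n \<Rightarrow> real ^ 'm ^ 'n \<Rightarrow> real ^ 'n ^ 'p \<Rightarrow> real ^ 'm ^ 'p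
    \<Rightarrow> real ^ 'n ^ 'n \<Rightarrow> real ^ 'm ^ 'n \<Rightarrow> real ^ 'n ^ 'n \<Rightarrow> real ^ 'n ^ 'n" where
  "Ric_op \<alpha> A B C D sx su U =
     \<alpha> *\<^sub>R (transpose A ** U ** A + Z_op sx U)
     - \<alpha> *\<^sub>R (transpose (Sigma_op \<alpha> A B C D U) ** matrix_inv (Lambda_op \<alpha> B D su U)
              ** Sigma_op \<alpha> A B C D U)
     + transpose C ** C"

definition gamma_of :: "real ^ 'm \<Rightarrow> real ^ 'm \<Rightarrow> real ^ 'm" where
  "gamma_of c z = (\<chi> i. min (c $ i) \<bar>z $ i\<bar> * sgn (z $ i))"

definition nu_of :: "real ^ 'm ^ 'm \<Rightarrow> real ^ 'm \<Rightarrow> real ^ 'm \<Rightarrow> real ^ 'm" where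
  "nu_of W c z = (\<chi> i. max 0 (diag_vec W $ i * (\<bar>z $ i\<bar> - c $ i)) * sgn (z $ i))"

text \<open>The recursion, as a property of the sequence \<open>z\<close>. The finite linearly ordered index type
  plays the role of \<open>{1..m}\<close>; since the entries of \<open>gamma_of c (z (Suc k))\<close> used for index \<open>i\<close>
  depend only on \<open>z (Suc k) $ j\<close> with \<open>j < i\<close>, this determines \<open>z\<close> from \<open>z 0\<close>.\<close>

definition sor_sequence ::
  "real ^ ('m::{finite,linorder}) ^ ('m::{finite,linorder})
    \<Rightarrow> real ^ ('m::{finite,linorder}) \<Rightarrow> real ^ ('m::{finite,linorder}) \<Rightarrow> real
    \<Rightarrow> (nat \<Rightarrow> real ^ ('m::{finite,linorder})) \<Rightarrow> bool"
where
  "sor_sequence W b c \<omega> z \<longleftrightarrow>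
     (\<forall>k i. z (Suc k) $ i =
        (1 - \<omega>) * z k $ i
        - \<omega> / W $ i $ i *
            ((\<Sum>j\<in>{..<i}. W $ i $ j * (gamma_of c (z (Suc k)) $ j + b $ j))
             + (\<Sum>j\<in>{i<..}. W $ i $ j * (gamma_of c (z k) $ j + b $ j)))
        - \<omega> * b $ i)"

lemma sor_sequence_exists:
  fixes W :: "real ^ ('m::{finite,linorder}) ^ ('m::{finite,linorder})"
  shows "\<exists>z. z 0 = z0 \<and> sor_sequence W b c \<omega> z"
proof -
  define P where "P = (\<lambda>y f i r. r =
        (1 - \<omega>) * y $ i
        - \<omega> / W $ i $ i *
            ((\<Sum>j\<in>{..<i}. W $ i $ j * (min (c $ j) \<bar>f j\<bar> * sgn (f j) + b $ j))
             + (\<Sum>j\<in>{i<..}. W $ i $ j * (gamma_of c y $ j + b $ j)))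
        - \<omega> * b $ i)"
  have wf: "wf {(j, i :: 'm). j < i}"
  proof (rule finite_acyclic_wf)
    have "trans {(j, i :: 'm). j < i}" by (auto intro: transI)
    then show "acyclic {(j, i :: 'm). j < i}" by (simp add: acyclic_def trancl_id)
  qed (rule finite)
  have step: "\<exists>f. \<forall>i. P y f i (f i)" for y
  proof (rule dependent_wf_choice[OF wf])
    fix f h :: "'m \<Rightarrow> real" and i r
    assume "\<And>j. (j, i) \<in> {(j, i :: 'm). j < i} \<Longrightarrow> f j = h j"
    then have "(\<Sum>j\<in>{..<i}. W $ i $ j * (min (c $ j) \<bar>f j\<bar> * sgn (f j) + b $ j))
        = (\<Sum>j\<in>{..<i}. W $ i $ j * (min (c $ j) \<bar>h j\<bar> * sgn (h j) + b $ j))"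
      by (intro sum.cong) simp_all
    then show "P y f i r = P y h i r"
      unfolding P_def by (rule arg_cong)
  next
    fix f :: "'m \<Rightarrow> real" and i
    show "\<exists>r. P y f i r" unfolding P_def by (rule exI, rule refl)
  qed
  have "\<exists>w. \<forall>i. P y (($) w) i (w $ i)" for y
  proof -
    obtain f where "\<forall>i. P y f i (f i)" using step by blast
    moreover have "($) (vec_lambda f) = f" by (rule ext) simp
    ultimately have "\<forall>i. P y (($) (vec_lambda f)) i (vec_lambda f $ i)" by (simp only: simp_thms)
    then show ?thesis by blast
  qed
  then obtain g where g: "\<And>y i. P y (($) (g y)) i (g y $ i)" by metis
  have "sor_sequence W b c \<omega> (\<lambda>k. (g ^^ k) z0)"
    unfolding sor_sequence_def
  proof (intro allI)
    fix k i
    show "(g ^^ Suc k) z0 $ i =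
        (1 - \<omega>) * (g ^^ k) z0 $ i
        - \<omega> / W $ i $ i *
            ((\<Sum>j\<in>{..<i}. W $ i $ j * (gamma_of c ((g ^^ Suc k) z0) $ j + b $ j))
             + (\<Sum>j\<in>{i<..}. W $ i $ j * (gamma_of c ((g ^^ k) z0) $ j + b $ j)))
        - \<omega> * b $ i"
      using g[of "(g ^^ k) z0" i, unfolded P_def]
      by (simp only: gamma_of_def vec_lambda_beta funpow.simps o_apply)
  qed
  then show ?thesis by (intro exI[of _ "\<lambda>k. (g ^^ k) z0"]) simp
qed

definition abs_subdiff :: "real ^ 'm \<Rightarrow> (real ^ 'm) set" where
  "abs_subdiff u =
     {\<xi>. \<forall>i. (u $ i \<noteq> 0 \<longrightarrow> \<xi> $ i = sgn (u $ i)) \<and> (u $ i = 0 \<longrightarrow> \<xi> $ i \<in> {-1..1})}"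

definition generalized_normal_eq ::
  "real ^ 'm ^ 'm \<Rightarrow> real ^ 'm \<Rightarrow> real ^ 'm \<Rightarrow> real ^ 'm \<Rightarrow> real ^ 'm \<Rightarrow> bool" where
  "generalized_normal_eq W b c u \<gamma> \<longleftrightarrow>
     matrix_inv W *v u + b + \<gamma> = 0 \<and> \<gamma> \<in> {c * \<xi> | \<xi>. \<xi> \<in> abs_subdiff u}"

end

theory Submission
  imports Defs
begin

text \<open>With \<open>\<omega> = 1\<close> the recursion is exact cyclic coordinate minimisation of the strictly convex
  function \<open>f \<gamma> = (\<gamma> + b) \<bullet> W (\<gamma> + b) / 2\<close> over the box \<open>\<bar>\<gamma>\<bar> \<le> c\<close>, and the outward part
  \<open>z - \<gamma>\<close> lies in the normal cone of the box at \<open>\<gamma>\<close>; multiplied by the diagonal of \<open>W\<close> it is \<open>\<nu>\<close>.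
  Every sweep decreases \<open>f\<close> by at least \<open>\<Sum>i. W i i * (\<Delta> i)\<^sup>2 / 2\<close>, where \<open>\<Delta>\<close> is the increment of
  \<open>\<gamma>\<close>, so \<open>\<Delta> \<rightarrow> 0\<close>. Moreover \<open>\<nu> = r - W (\<gamma> + b)\<close> with \<open>r\<close> the strict upper triangle of \<open>W\<close>
  applied to \<open>\<Delta>\<close>. Comparing two iterates through their variational inequalities bounds their
  distance by a multiple of that of the two values of \<open>r\<close>, so \<open>\<gamma>\<close> is Cauchy. The limit of the
  variational inequalities is the generalized normal equation.\<close>

section \<open>Definite and semidefinite matrices\<close>

lemma psd_congruence:
  fixes U :: "real ^ 'n ^ 'n" and S :: "real ^ 'm ^ 'n"
  assumes "psd U"
  shows "psd (transpose S ** U ** S)"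
proof -
  have "x \<bullet> ((transpose S ** U ** S) *v x) = (S *v x) \<bullet> (U *v (S *v x))" for x
    by (metis dot_lmul_matrix matrix_vector_mul_assoc transpose_matrix_vector transpose_transpose)
  then show ?thesis
    using assms by (simp add: psd_def matrix_transpose_mul matrix_mul_assoc)
qed

lemma psd_diag_nonneg:
  assumes "psd M"
  shows "0 \<le> M $ i $ i"
proof -
  have "axis i 1 \<bullet> (M *v axis i 1) = M $ i $ i"
    by (simp add: matrix_vector_mult_basis inner_axis' column_def)
  then show ?thesis
    using assms by (metis psd_def)
qed

lemma pd_diag_pos:
  assumes "pd M"
  shows "0 < M $ i $ i"
proof -
  have "axis i 1 \<bullet> (M *v axis i 1) = M $ i $ i"
    by (simp add: matrix_vector_mult_basis inner_axis' column_def)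
  moreover have "axis i (1::real) \<noteq> 0"
    by (simp add: axis_eq_0_iff)
  ultimately show ?thesis
    using assms by (metis pd_def)
qed

lemma psd_Diag:
  assumes "psd M"
  shows "psd (Diag M)"
proof -
  have "x \<bullet> (Diag M *v x) = (\<Sum>i\<in>UNIV. M $ i $ i * (x $ i)\<^sup>2)" for x
    by (simp add: inner_vec_def matrix_vector_mult_def Diag_def
        if_distrib [of "\<lambda>a. _ * a"] if_distrib [of "\<lambda>a. a * _"]
        power2_eq_square ac_simps cong: if_cong)
  then show ?thesis
    using psd_diag_nonneg [OF assms]
    by (auto simp: psd_def Diag_def transpose_def vec_eq_iff intro: sum_nonneg)
qed

lemma pd_scaleR:
  assumes "pd M" "0 < a"
  shows "pd (a *\<^sub>R M)"
  using assms by (simp add: pd_def transpose_scalar scaleR_matrix_vector_assoc [symmetric])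

lemma pd_add_psd:
  assumes "pd M" "psd N"
  shows "pd (N + M)"
proof -
  have "transpose (N + M) = N + M"
    using assms by (simp add: pd_def psd_def transpose_def vec_eq_iff)
  then show ?thesis
    using assms
    by (simp add: pd_def psd_def matrix_vector_mult_add_rdistrib inner_add_right add_nonneg_pos)
qed

lemma psd_add:
  assumes "psd M" "psd N"
  shows "psd (M + N)"
proof -
  have "transpose (M + N) = M + N"
    using assms by (simp add: psd_def transpose_def vec_eq_iff)
  then show ?thesis
    using assms
    by (simp add: psd_def matrix_vector_mult_add_rdistrib inner_add_right)
qed

text \<open>The congruence and \<open>Z_op\<close> terms inherit semidefiniteness from
  \<open>U\<close>; the term with \<open>transpose D ** D\<close> supplies strictness.\<close>

lemma pd_Lambda_op:
  assumes "0 < \<alpha>" "pd (transpose D ** D)" "psd U"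
  shows "pd (Lambda_op \<alpha> B D su U)"
  unfolding Lambda_op_def Z_op_def
  using assms by (intro pd_add_psd psd_add pd_scaleR psd_Diag psd_congruence) auto

lemma matrix_inv_inverse:
  assumes "invertible M"
  shows "M ** matrix_inv M = mat 1" "matrix_inv M ** M = mat 1"
  using someI_ex [OF assms [unfolded invertible_def]] by (simp_all add: matrix_inv_def)

lemma matrix_inv_mult_vec:
  assumes "invertible (M :: real ^ 'm ^ 'm)"
  shows "matrix_inv M *v (M *v x) = x" "M *v (matrix_inv M *v x) = x"
  using matrix_inv_inverse [OF assms] by (simp_all add: matrix_vector_mul_assoc)

lemma pd_invertible:
  assumes "pd M"
  shows "invertible M"
proof -
  have "x = 0" if "M *v x = 0" for x
    using assms that by (metis inner_zero_right less_irrefl pd_def)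
  then show ?thesis
    by (simp add: invertible_left_inverse matrix_left_invertible_ker)
qed

text \<open>The substitution \<open>x = M *v y\<close> turns the form of the inverse at
  \<open>x\<close> into that of \<open>M\<close> at \<open>y\<close>. Symmetry holds because the
  transposed inverse is again a left inverse of \<open>M\<close>.\<close>

lemma pd_matrix_inv:
  assumes "pd M"
  shows "pd (matrix_inv M)"
proof -
  have inv: "invertible M"
    by (rule pd_invertible [OF assms])
  have sym: "transpose M = M"
    using assms by (simp add: pd_def)
  have "transpose (matrix_inv M) ** M = mat 1"
    using matrix_inv_inverse(1) [OF inv] by (metis matrix_transpose_mul sym transpose_mat)
  then have "transpose (matrix_inv M) = matrix_inv M"
    using matrix_inv_inverse(1) [OF inv] by (metis matrix_mul_assoc matrix_mul_lid matrix_mul_rid)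
  moreover have "0 < x \<bullet> (matrix_inv M *v x)" if "x \<noteq> 0" for x
  proof -
    define y where "y = matrix_inv M *v x"
    have x: "x = M *v y"
      by (simp add: y_def matrix_inv_mult_vec [OF inv])
    then have "y \<noteq> 0"
      using that by auto
    then have "0 < y \<bullet> (M *v y)"
      using assms by (simp add: pd_def)
    then show ?thesis
      by (simp add: x matrix_inv_mult_vec [OF inv] inner_commute)
  qed
  ultimately show ?thesis
    by (simp add: pd_def)
qed

text \<open>By compactness the form attains its minimum on the unit sphere, and this positive
  minimum serves as \<open>l\<close>; homogeneity of degree two extends the bound to all
  vectors.\<close>

lemma pd_coercive:
  fixes M :: "real ^ 'm ^ 'm"
  assumes "pd M"
  obtains l where "0 < l" "\<And>x. l * (norm x)\<^sup>2 \<le> x \<bullet> (M *v x)"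
proof -
  have "continuous_on (sphere 0 1) (\<lambda>x. x \<bullet> (M *v x))"
    by (intro continuous_intros matrix_vector_mult_linear_continuous_on)
  then have "\<exists>y\<in>sphere 0 1. \<forall>x\<in>sphere 0 1. y \<bullet> (M *v y) \<le> x \<bullet> (M *v x)"
    by (intro continuous_attains_inf) auto
  then obtain y where y: "y \<in> sphere 0 1"
    and min: "\<And>x. x \<in> sphere 0 1 \<Longrightarrow> y \<bullet> (M *v y) \<le> x \<bullet> (M *v x)"
    by auto
  show thesis
  proof
    show "0 < y \<bullet> (M *v y)"
      using y assms by (cases "y = 0") (auto simp: pd_def)
    show "y \<bullet> (M *v y) * (norm x)\<^sup>2 \<le> x \<bullet> (M *v x)" for x
    proof (cases "x = 0")
      case False
      then have "y \<bullet> (M *v y) \<le> (x /\<^sub>R norm x) \<bullet> (M *v (x /\<^sub>R norm x))"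
        by (intro min) simp
      also have "\<dots> = x \<bullet> (M *v x) / (norm x)\<^sup>2"
        by (simp add: matrix_vector_mult_scaleR divide_inverse power2_eq_square)
      finally show ?thesis
        using False by (simp add: pos_le_divide_eq)
    qed simp
  qed
qed

section \<open>Projection onto the box and its normal cone\<close>

lemma clip_bound:
  fixes c z :: real
  assumes "0 \<le> c"
  shows "\<bar>min c \<bar>z\<bar> * sgn z\<bar> \<le> c"
  using assms by (auto simp: sgn_if abs_mult)

text \<open>The clipped value is the point of the interval from \<open>- c\<close> to
  \<open>c\<close> nearest to \<open>z\<close>; this is the obtuse-angle characterisation of that
  projection.\<close>

lemma clip_variational:
  fixes c y z :: real
  assumes "\<bar>y\<bar> \<le> c"
  shows "(z - min c \<bar>z\<bar> * sgn z) * (y - min c \<bar>z\<bar> * sgn z) \<le> 0"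
proof (cases "\<bar>z\<bar> \<le> c")
  case True
  then show ?thesis
    by (auto simp: sgn_if min_def)
next
  case False
  then show ?thesis
    using assms by (auto simp: sgn_if min_def mult_le_0_iff)
qed

text \<open>Inside the interval both sides vanish; outside, the residual of the projection is the
  excess over \<open>c $ i\<close> with the sign of \<open>z $ i\<close>.\<close>

lemma nu_of_nth:
  assumes "0 < W $ i $ i" "0 \<le> c $ i"
  shows "nu_of W c z $ i = W $ i $ i * (z $ i - gamma_of c z $ i)"
proof -
  have "max 0 (w * (\<bar>t\<bar> - d)) * sgn t = w * (t - min d \<bar>t\<bar> * sgn t)"
    if "0 < w" "0 \<le> d" for w t d :: real
    using that by (auto simp: max_def min_def sgn_if zero_le_mult_iff mult_le_0_iff algebra_simps)
  then show ?thesis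
    using assms by (simp add: nu_of_def gamma_of_def diag_vec_def)
qed

lemma gamma_of_bound:
  assumes "0 \<le> c $ i"
  shows "\<bar>gamma_of c z $ i\<bar> \<le> c $ i"
  using clip_bound [OF assms] by (simp add: gamma_of_def)

lemma nu_of_variational:
  assumes "0 < W $ i $ i" "\<bar>y\<bar> \<le> c $ i"
  shows "nu_of W c z $ i * (y - gamma_of c z $ i) \<le> 0"
proof -
  have "0 \<le> c $ i"
    using assms(2) by linarith
  then have "nu_of W c z $ i * (y - gamma_of c z $ i)
    = W $ i $ i * ((z $ i - gamma_of c z $ i) * (y - gamma_of c z $ i))"
    using assms by (simp add: nu_of_nth)
  also have "\<dots> \<le> 0"
    using assms(1) clip_variational [OF assms(2), of "z $ i"]
    by (auto simp: gamma_of_def intro: mult_nonneg_nonpos)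
  finally show ?thesis .
qed

lemma nu_of_inner_gamma_of_diff:
  assumes "\<And>i. 0 < W $ i $ i" "\<And>i. 0 \<le> c $ i"
  shows "nu_of W c z \<bullet> (gamma_of c y - gamma_of c z) \<le> 0"
  unfolding inner_vec_def
  using assms by (auto intro!: sum_nonpos nu_of_variational gamma_of_bound)

section \<open>Identities and descent for one sweep\<close>

text \<open>The indices above \<open>i\<close> are those that a sweep has not yet updated when it
  reaches coordinate \<open>i\<close>.\<close>

definition upper_part ::
  "real ^ ('m::{finite,linorder}) ^ ('m::{finite,linorder})
    \<Rightarrow> real ^ ('m::{finite,linorder}) \<Rightarrow> real ^ ('m::{finite,linorder})" where
  "upper_part W d = (\<chi> i. \<Sum>j\<in>{i<..}. W $ i $ j * d $ j)"

lemma sum_split_linorder: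
  fixes f :: "'m::{finite,linorder} \<Rightarrow> real"
  shows "sum f UNIV = sum f {..<i} + f i + sum f {i<..}"
proof -
  have "UNIV = insert i ({..<i} \<union> {i<..})"
    by auto
  then have "sum f UNIV = sum f (insert i ({..<i} \<union> {i<..}))"
    by simp
  also have "\<dots> = f i + (sum f {..<i} + sum f {i<..})"
    by (subst sum.insert) (auto intro!: sum.union_disjoint)
  finally show ?thesis by simp
qed

text \<open>For \<omega> = 1 the previous \<open>z\<close> drops out. Multiplying the update by
  \<open>W $ i $ i\<close> and subtracting the diagonal term in \<gamma> completes the row sum,
  except that the entries above \<open>i\<close> are still old; \<open>upper_part\<close> of the
  increment corrects for them.\<close>

lemma sor_nu_of:
  fixes W :: "real ^ ('m::{finite,linorder}) ^ ('m::{finite,linorder})"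
  assumes "sor_sequence W b c 1 z" "\<And>i. 0 < W $ i $ i" "\<And>i. 0 \<le> c $ i"
  shows "nu_of W c (z (Suc k))
    = upper_part W (gamma_of c (z (Suc k)) - gamma_of c (z k))
      - W *v (gamma_of c (z (Suc k)) + b)"
    (is "_ = upper_part W (?g' - ?g) - _")
proof (rule vec_eq_iff [THEN iffD2], rule allI)
  fix i
  have "W $ i $ i * z (Suc k) $ i = - ((\<Sum>j\<in>{..<i}. W $ i $ j * (?g' $ j + b $ j))
             + (\<Sum>j\<in>{i<..}. W $ i $ j * (?g $ j + b $ j))) - W $ i $ i * b $ i"
    using assms(1) [unfolded sor_sequence_def, rule_format, of k i] assms(2) [of i]
    by (simp add: field_simps)
  then show "nu_of W c (z (Suc k)) $ i = (upper_part W (?g' - ?g) - W *v (?g' + b)) $ i"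
    using assms(2) [of i] assms(3) [of i]
    by (simp add: nu_of_nth upper_part_def matrix_vector_mult_def sum_split_linorder [of _ i]
        algebra_simps sum.distrib sum_subtractf)
qed

text \<open>By symmetry the two strict triangles contribute equally to the form.\<close>

lemma quadratic_form_upper_part:
  fixes W :: "real ^ ('m::{finite,linorder}) ^ ('m::{finite,linorder})"
  assumes "transpose W = W"
  shows "d \<bullet> (W *v d) = 2 * (d \<bullet> upper_part W d) + (\<Sum>i\<in>UNIV. W $ i $ i * (d $ i)\<^sup>2)"
proof -
  have sym: "W $ i $ j = W $ j $ i" for i j
    using assms by (metis transpose_def vec_lambda_beta)
  define a where "a i j = d $ i * (W $ i $ j * d $ j)" for i j
  have a_sym: "a i j = a j i" for i j
    by (simp add: a_def sym [of i j])
  have "(\<Sum>i\<in>UNIV. \<Sum>j\<in>{..<i}. a i j) = (\<Sum>j\<in>UNIV. \<Sum>i\<in>{j<..}. a i j)"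
    using sum.swap_restrict [of UNIV UNIV a "\<lambda>i j. j < i"]
    by (simp add: lessThan_def greaterThan_def)
  also have "\<dots> = d \<bullet> upper_part W d"
    by (subst a_sym) (simp add: inner_vec_def upper_part_def a_def sum_distrib_left)
  finally have lower: "(\<Sum>i\<in>UNIV. \<Sum>j\<in>{..<i}. a i j) = d \<bullet> upper_part W d" .
  have "d \<bullet> (W *v d) = (\<Sum>i\<in>UNIV. \<Sum>j\<in>UNIV. a i j)"
    by (simp add: inner_vec_def matrix_vector_mult_def a_def sum_distrib_left)
  also have "\<dots> = (\<Sum>i\<in>UNIV. (\<Sum>j\<in>{..<i}. a i j) + a i i + (\<Sum>j\<in>{i<..}. a i j))"
    by (intro sum.cong refl sum_split_linorder)
  also have "\<dots> = d \<bullet> upper_part W d + (\<Sum>i\<in>UNIV. a i i) + (\<Sum>i\<in>UNIV. \<Sum>j\<in>{i<..}. a i j)"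
    by (simp add: sum.distrib lower)
  also have "(\<Sum>i\<in>UNIV. \<Sum>j\<in>{i<..}. a i j) = d \<bullet> upper_part W d"
    by (simp add: inner_vec_def upper_part_def a_def sum_distrib_left)
  finally show ?thesis
    by (simp add: a_def power2_eq_square ac_simps)
qed

text \<open>The decrease is
  \<open>d \<bullet> (W *v d) - 2 * (d \<bullet> (W *v v (Suc k)))\<close>. Inserting the identity
  for \<nu> cancels the triangular parts and leaves the diagonal sum plus
  \<open>2 * (d \<bullet> nu_of W c (z (Suc k)))\<close>, which is nonnegative because the old
  \<gamma> lies in the box.\<close>

lemma sor_descent:
  fixes W :: "real ^ ('m::{finite,linorder}) ^ ('m::{finite,linorder})"
  assumes "sor_sequence W b c 1 z" "pd W" "\<And>i. 0 \<le> c $ i"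
  defines "v \<equiv> \<lambda>k. gamma_of c (z k) + b"
  shows "(\<Sum>i\<in>UNIV. W $ i $ i * ((v (Suc k) - v k) $ i)\<^sup>2)
    \<le> v k \<bullet> (W *v v k) - v (Suc k) \<bullet> (W *v v (Suc k))"
proof -
  define d where "d = v (Suc k) - v k"
  have d: "d = gamma_of c (z (Suc k)) - gamma_of c (z k)"
    by (simp add: d_def v_def)
  have sym: "transpose W = W"
    using assms by (simp add: pd_def)
  have "v (Suc k) \<bullet> (W *v d) = d \<bullet> (W *v v (Suc k))"
    by (metis dot_lmul_matrix inner_commute sym transpose_matrix_vector)
  moreover have "v k = v (Suc k) - d"
    by (simp add: d_def)
  ultimately have "v k \<bullet> (W *v v k) - v (Suc k) \<bullet> (W *v v (Suc k))
      = d \<bullet> (W *v d) - 2 * (d \<bullet> (W *v v (Suc k)))"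
    by (simp add: matrix_vector_mult_diff_distrib inner_diff)
  moreover have "W *v v (Suc k) = upper_part W d - nu_of W c (z (Suc k))"
    using sor_nu_of [OF assms(1) pd_diag_pos [OF assms(2)] assms(3)] by (simp add: d v_def)
  moreover have "0 \<le> d \<bullet> nu_of W c (z (Suc k))"
    using nu_of_inner_gamma_of_diff [OF pd_diag_pos [OF assms(2)] assms(3),
        where z = "z (Suc k)" and y = "z k"]
    by (simp add: d inner_commute inner_diff)
  ultimately show ?thesis
    using quadratic_form_upper_part [OF sym, of d]
    by (simp add: d_def [symmetric] inner_diff)
qed

lemma sor_increment_tendsto_0:
  fixes W :: "real ^ ('m::{finite,linorder}) ^ ('m::{finite,linorder})"
  assumes "sor_sequence W b c 1 z" "pd W" "\<And>i. 0 \<le> c $ i"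
  shows "(\<lambda>k. gamma_of c (z (Suc k)) - gamma_of c (z k)) \<longlonglongrightarrow> 0"
proof -
  define v where "v = (\<lambda>k. gamma_of c (z k) + b)"
  define f where "f k = v k \<bullet> (W *v v k)" for k
  have descent: "(\<Sum>i\<in>UNIV. W $ i $ i * ((v (Suc k) - v k) $ i)\<^sup>2) \<le> f k - f (Suc k)" for k
    unfolding f_def v_def by (rule sor_descent [OF assms])
  have pos: "0 < W $ i $ i" for i
    by (rule pd_diag_pos [OF assms(2)])
  have nonneg: "0 \<le> f k" for k
    using assms(2) unfolding f_def pd_def by (cases "v k = 0") (auto intro: less_imp_le)
  have coord: "W $ i $ i * ((v (Suc k) - v k) $ i)\<^sup>2 \<le> f k - f (Suc k)" for i k
  proof -
    have "W $ i $ i * ((v (Suc k) - v k) $ i)\<^sup>2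
        \<le> (\<Sum>i\<in>UNIV. W $ i $ i * ((v (Suc k) - v k) $ i)\<^sup>2)"
      by (rule member_le_sum) (use less_imp_le [OF pos] in auto)
    then show ?thesis
      using descent [of k] by linarith
  qed
  \<comment> \<open>Any single coordinate shows the decrease; \<open>undefined\<close> merely names
    an index.\<close>
  have "f (Suc k) \<le> f k" for k
    using coord [of undefined k] mult_nonneg_nonneg [OF less_imp_le [OF pos] zero_le_power2]
    by (metis diff_ge_0_iff_ge order.trans)
  then have "decseq f"
    by (simp add: decseq_Suc_iff)
  then have "convergent f"
    using decseq_convergent [of f 0] nonneg unfolding convergent_def by metis
  then obtain L where L: "f \<longlonglongrightarrow> L"
    by (auto simp: convergent_def)
  have gap: "(\<lambda>k. f k - f (Suc k)) \<longlonglongrightarrow> 0"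
    using tendsto_diff [OF L LIMSEQ_Suc [OF L]] by simp
  have "(\<lambda>k. (v (Suc k) - v k) $ i) \<longlonglongrightarrow> 0" for i
  proof -
    have "(\<lambda>k. (f k - f (Suc k)) / W $ i $ i) \<longlonglongrightarrow> 0"
      using tendsto_divide [OF gap tendsto_const, of "W $ i $ i"] pos [of i] by simp
    then have "(\<lambda>k. ((v (Suc k) - v k) $ i)\<^sup>2) \<longlonglongrightarrow> 0"
      by (rule tendsto_sandwich [OF _ _ tendsto_const, rotated 2])
        (use coord [of i] pos [of i] in \<open>auto simp: field_simps\<close>)
    then have "(\<lambda>k. sqrt (((v (Suc k) - v k) $ i)\<^sup>2)) \<longlonglongrightarrow> sqrt 0"
      by (rule tendsto_real_sqrt)
    then show ?thesis
      by (simp add: tendsto_rabs_zero_iff)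
  qed
  then have "(\<lambda>k. v (Suc k) - v k) \<longlonglongrightarrow> 0"
    by (intro vec_tendstoI) simp
  then show ?thesis
    by (simp add: v_def)
qed

section \<open>Convergence and the limiting equation\<close>

text \<open>Where \<open>u $ i\<close> is nonzero, testing with both endpoints of the interval
  forces \<gamma> to the endpoint with the sign of \<open>u $ i\<close>.\<close>

lemma generalized_normal_eqI:
  assumes "invertible W" and u: "u = - (W *v (\<gamma> + b))"
    and bound: "\<And>i. \<bar>\<gamma> $ i\<bar> \<le> c $ i"
    and vi: "\<And>i y. \<bar>y\<bar> \<le> c $ i \<Longrightarrow> u $ i * (y - \<gamma> $ i) \<le> 0"
  shows "generalized_normal_eq W b c u \<gamma>"
proof -
  \<comment> \<open>If \<open>c $ i = 0\<close>, the bound gives \<open>\<gamma> $ i = 0\<close>,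
    and division by zero yields the admissible value 0.\<close>
  define \<xi> where "\<xi> = (\<chi> i. if u $ i = 0 then \<gamma> $ i / c $ i else sgn (u $ i))"
  have "\<gamma> $ i = c $ i * \<xi> $ i" for i
  proof (cases "u $ i = 0")
    case True
    then show ?thesis
      using bound [of i] by (auto simp: \<xi>_def)
  next
    case False
    then show ?thesis
      using vi [of "c $ i" i] vi [of "- c $ i" i] bound [of i]
      by (auto simp: \<xi>_def sgn_if mult_le_0_iff)
  qed
  moreover have "\<xi> \<in> abs_subdiff u"
  proof -
    have "\<bar>\<gamma> $ i / c $ i\<bar> \<le> 1" for i
      using bound [of i] by (auto simp: divide_le_eq_1)
    then have "\<gamma> $ i / c $ i \<in> {- 1..1}" for i
      by (metis abs_le_iff atLeastAtMost_iff minus_le_iff)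
    then show ?thesis
      by (simp add: abs_subdiff_def \<xi>_def)
  qed
  ultimately have "\<gamma> \<in> {c * \<xi> | \<xi>. \<xi> \<in> abs_subdiff u}"
    by (auto simp: vec_eq_iff)
  moreover have "matrix_inv W *v u = - (\<gamma> + b)"
    using matrix_inv_mult_vec(1) [OF assms(1), of "\<gamma> + b"]
    by (simp add: u linear_neg [OF matrix_vector_mul_linear])
  ultimately show ?thesis
    by (simp add: generalized_normal_eq_def)
qed

lemma sor_converges:
  fixes W :: "real ^ ('m::{finite,linorder}) ^ ('m::{finite,linorder})"
  assumes sor: "sor_sequence W b c 1 z" and pd: "pd W" and c: "\<And>i. 0 \<le> c $ i"
  obtains \<gamma> u where "(\<lambda>k. gamma_of c (z k)) \<longlonglongrightarrow> \<gamma>" "(\<lambda>k. nu_of W c (z k)) \<longlonglongrightarrow> u"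
    "generalized_normal_eq W b c u \<gamma>"
proof -
  have pos: "0 < W $ i $ i" for i
    by (rule pd_diag_pos [OF pd])
  \<comment> \<open>The shift by one is needed because the identity for \<nu> holds only after a
    sweep; \<open>LIMSEQ_imp_Suc\<close> undoes it at the end.\<close>
  define g where "g k = gamma_of c (z (Suc k))" for k
  define n where "n k = nu_of W c (z (Suc k))" for k
  define r where "r k = upper_part W (gamma_of c (z (Suc k)) - gamma_of c (z k))" for k
  have n: "n k = r k - W *v (g k + b)" for k
    using sor_nu_of [OF sor pos c] by (simp add: n_def r_def g_def)
  have r: "r \<longlonglongrightarrow> 0"
  proof (rule vec_tendstoI)
    fix i
    have "(\<lambda>k. (gamma_of c (z (Suc k)) - gamma_of c (z k)) $ j) \<longlonglongrightarrow> 0" for j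
      using tendsto_vec_nth [OF sor_increment_tendsto_0 [OF sor pd c]] by simp
    then show "(\<lambda>k. r k $ i) \<longlonglongrightarrow> 0 $ i"
      unfolding r_def upper_part_def by (auto intro!: tendsto_null_sum tendsto_mult_right_zero)
  qed
  obtain l where l: "0 < l" "\<And>x. l * (norm x)\<^sup>2 \<le> x \<bullet> (W *v x)"
    using pd_coercive [OF pd] by blast
  \<comment> \<open>Each iterate is a test point in the variational inequality of the other, so the
    \<nu> terms have a favourable sign. Coercivity and Cauchy-Schwarz then give the bound.\<close>
  have dist: "dist (g j) (g k) \<le> dist (r j) (r k) / l" for j k
  proof -
    define e where "e = g j - g k"
    have "W *v e = (r j - r k) - (n j - n k)"
      by (simp add: e_def n matrix_vector_mult_diff_distrib matrix_vector_right_distrib)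
    then have "e \<bullet> (W *v e) = e \<bullet> (r j - r k) + n j \<bullet> (g k - g j) + n k \<bullet> (g j - g k)"
      by (simp add: e_def inner_diff inner_commute [of "n _"])
    moreover have "n j \<bullet> (g k - g j) \<le> 0" "n k \<bullet> (g j - g k) \<le> 0"
      unfolding n_def g_def by (rule nu_of_inner_gamma_of_diff [OF pos c])+
    ultimately have "e \<bullet> (W *v e) \<le> e \<bullet> (r j - r k)"
      by linarith
    then have "l * (norm e)\<^sup>2 \<le> norm e * norm (r j - r k)"
      using l(2) [of e] norm_cauchy_schwarz [of e "r j - r k"] by linarith
    then have "l * norm e \<le> norm (r j - r k)"
      by (cases "e = 0") (auto simp: power2_eq_square)
    then show ?thesis
      using l(1) by (simp add: dist_norm e_def field_simps)
  qed
  have "Cauchy g"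
  proof (rule metric_CauchyI)
    fix \<epsilon> :: real assume "0 < \<epsilon>"
    then obtain N where N: "\<forall>j\<ge>N. \<forall>k\<ge>N. dist (r j) (r k) < \<epsilon> * l"
      using metric_CauchyD [OF LIMSEQ_imp_Cauchy [OF r], of "\<epsilon> * l"] l(1) by auto
    then show "\<exists>N. \<forall>j\<ge>N. \<forall>k\<ge>N. dist (g j) (g k) < \<epsilon>"
      using dist l(1) by (meson order.strict_trans1 pos_divide_less_eq)
  qed
  then obtain \<gamma> where \<gamma>: "g \<longlonglongrightarrow> \<gamma>"
    using Cauchy_convergent convergent_def by blast
  define u where "u = - (W *v (\<gamma> + b))"
  have "(\<lambda>k. W *v (g k + b)) \<longlonglongrightarrow> W *v (\<gamma> + b)"
    by (intro bounded_linear.tendsto [OF matrix_vector_mul_bounded_linear] tendsto_add \<gamma> tendsto_const)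
  then have u: "n \<longlonglongrightarrow> u"
    using tendsto_diff [OF r] unfolding n u_def by fastforce
  \<comment> \<open>The box constraint and the variational inequalities are closed conditions, so
    they pass to the limit.\<close>
  have "generalized_normal_eq W b c u \<gamma>"
  proof (rule generalized_normal_eqI [OF pd_invertible [OF pd] u_def])
    fix i
    show "\<bar>\<gamma> $ i\<bar> \<le> c $ i"
      by (rule LIMSEQ_le_const2 [OF tendsto_rabs [OF tendsto_vec_nth [OF \<gamma>]]])
        (use gamma_of_bound [OF c] in \<open>auto simp: g_def\<close>)
    fix y assume "\<bar>y\<bar> \<le> c $ i"
    then show "u $ i * (y - \<gamma> $ i) \<le> 0"
      by (intro LIMSEQ_le_const2
            [OF tendsto_mult [OF tendsto_vec_nth [OF u]
                tendsto_diff [OF tendsto_const tendsto_vec_nth [OF \<gamma>]]]])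
        (use nu_of_variational [of W i, OF pos] in \<open>auto simp: n_def g_def\<close>)
  qed
  moreover have "(\<lambda>k. gamma_of c (z k)) \<longlonglongrightarrow> \<gamma>" "(\<lambda>k. nu_of W c (z k)) \<longlonglongrightarrow> u"
    by (rule LIMSEQ_imp_Suc, simp flip: g_def n_def add: \<gamma> u)+
  ultimately show thesis
    using that by blast
qed

theorem theorem4p2:
  fixes \<alpha> :: real
    and A \<sigma>bar_x L :: "real ^ 'n ^ 'n"
    and B \<sigma>_u \<sigma>bar_u :: "real ^ ('m::{finite,linorder}) ^ 'n"
    and C :: "real ^ 'n ^ 'p"
    and D :: "real ^ ('m::{finite,linorder}) ^ 'p"
    and x \<mu> :: "real ^ 'n"
    and W :: "real ^ ('m::{finite,linorder}) ^ ('m::{finite,linorder})"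
    and b c :: "real ^ ('m::{finite,linorder})"
  assumes "\<alpha> > 0"
    and "pd (transpose D ** D)"
    and "psd L"
    and "L - Ric_op \<alpha> A B C D \<sigma>bar_x \<sigma>bar_u L = 0"
    and "invertible (Lambda_op \<alpha> B D \<sigma>bar_u L)"
    and "linear_positive (Wu_op \<sigma>_u \<sigma>bar_u)"
    and "W = (1/2) *\<^sub>R matrix_inv (Lambda_op \<alpha> B D \<sigma>bar_u L)"
    and "b = \<alpha> *\<^sub>R (transpose B *v \<mu> + 2 *\<^sub>R (Sigma_op \<alpha> A B C D L *v x))"
    and "c = \<alpha> *\<^sub>R diag_vec (Wu_op \<sigma>_u \<sigma>bar_u L)"
  shows "\<exists>\<omega>. 0 < \<omega> \<and> \<omega> < 2 \<and>
    (\<forall>z0 z. z 0 = z0 \<and> sor_sequence W b c \<omega> z \<longrightarrow>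
      (\<exists>\<gamma>s vs. (\<lambda>k. gamma_of c (z k)) \<longlonglongrightarrow> \<gamma>s \<and>
               (\<lambda>k. nu_of W c (z k)) \<longlonglongrightarrow> vs \<and>
               generalized_normal_eq W b c vs \<gamma>s))"
\<comment> \<open>The witness \<omega> = 1 makes every coordinate update an exact
  minimisation.\<close>
proof (rule exI [of _ 1], intro conjI allI impI)
  fix z0 z
  assume z: "z 0 = z0 \<and> sor_sequence W b c 1 z"
  have "pd (Lambda_op \<alpha> B D \<sigma>bar_u L)"
    using assms(1-3) by (rule pd_Lambda_op)
  then have "pd W"
    unfolding assms(7) by (intro pd_scaleR pd_matrix_inv) simp_all
  \<comment> \<open>Linear positivity at the semidefinite \<open>L\<close> makes the diagonal of
    \<open>Wu_op\<close> nonnegative.\<close>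
  moreover have "0 \<le> c $ i" for i
    using assms(1,3,6) psd_diag_nonneg [of "Wu_op \<sigma>_u \<sigma>bar_u L" i]
    by (simp add: assms(9) diag_vec_def linear_positive_def)
  ultimately show "\<exists>\<gamma>s vs. (\<lambda>k. gamma_of c (z k)) \<longlonglongrightarrow> \<gamma>s \<and>
               (\<lambda>k. nu_of W c (z k)) \<longlonglongrightarrow> vs \<and>
               generalized_normal_eq W b c vs \<gamma>s"
    using sor_converges z by metis
qed simp_all

end
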